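(* Let $\mathcal M=(M,d,(q_i))$ be a computable metric space and $x\in M$. Then $x$ is computable if and only if $x$ is locally $C$-trivial, i.e. there is $b\in\mathbb N$ such that for every $n$ there is a special point $p$ with $d(x,p)<2^{-n}$ and $C(p,n)\le C(n)+b$.
   Context: $C$ denotes plain Kolmogorov complexity, $C(p,n)$ the plain complexity of the pair $\langle p,n\rangle$. A computable metric space is a complete separable metric space with a dense sequence of special points $(q_i)$ (identified with $i\in\mathbb N$) such that $d(q_i,q_k)$ is computable uniformly in $i,k$. A point is computable if it has a computable Cauchy name, i.e. a computable $\alpha:\mathbb N\to\mathbb N$ with $d(q_{\alpha(s)},q_{\alpha(t)})\le 2^{-s}$ for $t\ge s$ and $\lim_sq_{\alpha(s)}=x$. *)

theory Defs
  imports "HOL-Analysis.Analysis" "HOL-Library.Nat_Bijection"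
begin

datatype rf = Zero | Succ | Ident | Left | Right
  | Pair rf rf | Comp rf rf | Prec rf rf | Mu rf

inductive eval :: "rf \<Rightarrow> nat \<Rightarrow> nat \<Rightarrow> bool" where
  "eval Zero x 0"
| "eval Succ x (Suc x)"
| "eval Ident x x"
| "eval Left x (fst (prod_decode x))"
| "eval Right x (snd (prod_decode x))"
| "eval f x y \<Longrightarrow> eval g x z \<Longrightarrow> eval (Pair f g) x (prod_encode (y, z))"
| "eval g x y \<Longrightarrow> eval f y z \<Longrightarrow> eval (Comp f g) x z"
| "eval f a y \<Longrightarrow> eval (Prec f g) (prod_encode (a, 0)) y"
| "eval (Prec f g) (prod_encode (a, n)) y \<Longrightarrow>
     eval g (prod_encode (a, prod_encode (n, y))) z \<Longrightarrow>
     eval (Prec f g) (prod_encode (a, Suc n)) z"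
| "eval f (prod_encode (a, n)) 0 \<Longrightarrow>
     (\<forall>m<n. \<exists>y. eval f (prod_encode (a, m)) y \<and> y > 0) \<Longrightarrow>
     eval (Mu f) a n"

definition partial_computable :: "(nat \<Rightarrow> nat option) \<Rightarrow> bool" where
  "partial_computable \<phi> \<longleftrightarrow> (\<exists>f. \<forall>x y. eval f x y \<longleftrightarrow> \<phi> x = Some y)"

definition total_computable :: "(nat \<Rightarrow> nat) \<Rightarrow> bool" where
  "total_computable \<alpha> \<longleftrightarrow> partial_computable (\<lambda>x. Some (\<alpha> x))"

text \<open>Natural numbers are identified with binary strings in the standard bijective way
  (0 = empty string, 1 = "0", 2 = "1", 3 = "00", ...); the length of the string coded by n
  is floor(log2(n+1)).\<close>

definition slen :: "nat \<Rightarrow> nat" where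
  "slen n = nat \<lfloor>log 2 (real (n + 1))\<rfloor>"

definition optimal_machine :: "(nat \<Rightarrow> nat option) \<Rightarrow> bool" where
  "optimal_machine U \<longleftrightarrow> partial_computable U \<and>
     (\<forall>V. partial_computable V \<longrightarrow>
        (\<exists>c. \<forall>\<sigma> x. V \<sigma> = Some x \<longrightarrow> (\<exists>\<tau>. U \<tau> = Some x \<and> slen \<tau> \<le> slen \<sigma> + c)))"

definition KC :: "(nat \<Rightarrow> nat option) \<Rightarrow> nat \<Rightarrow> nat" where
  "KC U x = (LEAST k. \<exists>\<sigma>. slen \<sigma> = k \<and> U \<sigma> = Some x)"

definition computable_metric_space :: "(nat \<Rightarrow> 'a::complete_space) \<Rightarrow> bool" where
  "computable_metric_space q \<longleftrightarrow> closure (range q) = UNIV \<and>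
     (\<exists>f. total_computable f \<and>
        (\<forall>i k s. \<bar>dist (q i) (q k) - real_of_int (int_decode (f (prod_encode (i, prod_encode (k, s))))) / 2 ^ s\<bar>
                   \<le> 1 / 2 ^ s))"

definition computable_point :: "(nat \<Rightarrow> 'a::metric_space) \<Rightarrow> 'a \<Rightarrow> bool" where
  "computable_point q x \<longleftrightarrow> (\<exists>\<alpha>. total_computable \<alpha> \<and>
     (\<forall>s t. s \<le> t \<longrightarrow> dist (q (\<alpha> s)) (q (\<alpha> t)) \<le> 1 / 2 ^ s) \<and>
     (\<lambda>s. q (\<alpha> s)) \<longlonglongrightarrow> x)"

definition locally_C_trivial :: "(nat \<Rightarrow> nat option) \<Rightarrow> (nat \<Rightarrow> 'a::metric_space) \<Rightarrow> 'a \<Rightarrow> bool" where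
  "locally_C_trivial U q x \<longleftrightarrow> (\<exists>b::nat. \<forall>n. \<exists>p.
     dist x (q p) < 1 / 2 ^ n \<and> KC U (prod_encode (p, n)) \<le> KC U n + b)"

end

theory Submission
  imports Defs
begin

text \<open>For the harder direction, the assumption gives a constant \<open>B\<close> such that for every \<open>n\<close> some
  \<open>p\<close> with \<open>d(x, p) < 2\<^sup>-\<^sup>n\<close> lies in the c.e. set \<open>S\<^sub>n\<close> of those \<open>p\<close> for which \<open>\<langle>p, n\<rangle>\<close> has a program below
  \<open>B (n + 1)\<close>. By the pigeonhole principle every interval \<open>[L, 2 L)\<close> contains an \<open>n\<close> with at most
  \<open>2 B\<close> such programs. Let \<open>A k\<close> be the c.e. set of special points lying within \<open>2 / 2\<^sup>n\<close> of \<open>S\<^sub>n\<close> for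
  all \<open>n < 2 k + 2\<close>. Then \<open>A k\<close> contains all special points close to \<open>x\<close>, but no \<open>2 B + 1\<close> points that
  are pairwise more than \<open>4 / 2\<^sup>k\<close> apart. It follows that \<open>x\<close> is isolated among the points
  approximated by all the \<open>A k\<close>. Let \<open>w\<close> be the largest number such that infinitely many \<open>A k\<close>
  contain \<open>w\<close> points so separated. For large \<open>k\<close>, any \<open>w\<close> separated points of \<open>A k\<close> that an enumeration finds
  must include one near \<open>x\<close>, and by isolation those in a fixed small ball around \<open>x\<close> get arbitrarily close
  together; searching for this to happen computes \<open>x\<close>.\<close>

section \<open>Computable functions and decidable predicates\<close>

abbreviation p1 :: "nat \<Rightarrow> nat" where "p1 x \<equiv> fst (prod_decode x)"
abbreviation p2 :: "nat \<Rightarrow> nat" where "p2 x \<equiv> snd (prod_decode x)"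
abbreviation pr :: "nat \<Rightarrow> nat \<Rightarrow> nat" where "pr x y \<equiv> prod_encode (x, y)"

section \<open>Inversion of the evaluation relation\<close>

inductive_cases eval_ZeroE: "eval Zero x y"
inductive_cases eval_SuccE: "eval Succ x y"
inductive_cases eval_IdentE: "eval Ident x y"
inductive_cases eval_LeftE: "eval Left x y"
inductive_cases eval_RightE: "eval Right x y"
inductive_cases eval_PairE: "eval (Pair f g) x y"
inductive_cases eval_CompE: "eval (Comp f g) x y"
inductive_cases eval_PrecE: "eval (Prec f g) x y"
inductive_cases eval_MuE: "eval (Mu f) x y"

lemma eval_Zero_iff: "eval Zero x y \<longleftrightarrow> y = 0"
  by (auto elim: eval_ZeroE intro: eval.intros)

lemma eval_Succ_iff: "eval Succ x y \<longleftrightarrow> y = Suc x"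
  by (auto elim: eval_SuccE intro: eval.intros)

lemma eval_Ident_iff: "eval Ident x y \<longleftrightarrow> y = x"
  by (auto elim: eval_IdentE intro: eval.intros)

lemma eval_Left_iff: "eval Left x y \<longleftrightarrow> y = p1 x"
  by (auto elim: eval_LeftE intro: eval.intros)

lemma eval_Right_iff: "eval Right x y \<longleftrightarrow> y = p2 x"
  by (auto elim: eval_RightE intro: eval.intros)

lemma eval_Pair_iff: "eval (Pair f g) x z \<longleftrightarrow> eval f x (p1 z) \<and> eval g x (p2 z)"
proof
  assume "eval f x (p1 z) \<and> eval g x (p2 z)"
  then have "eval (Pair f g) x (pr (p1 z) (p2 z))"
    by (intro eval.intros) auto
  then show "eval (Pair f g) x z" by simp
qed (auto elim: eval_PairE)

lemma eval_Comp_iff: "eval (Comp f g) x z \<longleftrightarrow> (\<exists>y. eval g x y \<and> eval f y z)"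
  by (auto elim: eval_CompE intro: eval.intros)

lemma eval_Mu_iff:
  "eval (Mu f) a n \<longleftrightarrow> eval f (pr a n) 0 \<and> (\<forall>m<n. \<exists>y. eval f (pr a m) y \<and> y > 0)"
  by (auto elim: eval_MuE intro: eval.intros)

lemma eval_Prec_0_iff: "eval (Prec f g) (pr a 0) y \<longleftrightarrow> eval f a y"
  by (auto elim: eval_PrecE intro: eval.intros)

lemma eval_Prec_Suc_iff:
  "eval (Prec f g) (pr a (Suc n)) z \<longleftrightarrow>
     (\<exists>y. eval (Prec f g) (pr a n) y \<and> eval g (pr a (pr n y)) z)"
proof
  assume "eval (Prec f g) (pr a (Suc n)) z"
  then show "\<exists>y. eval (Prec f g) (pr a n) y \<and> eval g (pr a (pr n y)) z"
    by (rule eval_PrecE) auto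
qed (auto intro: eval.intros)

section \<open>Closure properties of total computable functions\<close>

lemma total_computable_iff: "total_computable h \<longleftrightarrow> (\<exists>f. \<forall>x y. eval f x y \<longleftrightarrow> y = h x)"
  by (auto simp: total_computable_def partial_computable_def eq_commute)

named_theorems comp_intros

lemma tc_ident [comp_intros]: "total_computable (\<lambda>x. x)"
  unfolding total_computable_iff by (rule exI[of _ Ident]) (simp add: eval_Ident_iff)

lemma tc_comp:
  assumes "total_computable h" "total_computable g"
  shows "total_computable (\<lambda>x. h (g x))"
proof -
  from assms obtain h' g' where
    "\<forall>x y. eval h' x y \<longleftrightarrow> y = h x" "\<forall>x y. eval g' x y \<longleftrightarrow> y = g x"
    by (auto simp: total_computable_iff)
  then show ?thesis
    unfolding total_computable_iff by (intro exI[of _ "Comp h' g'"]) (simp add: eval_Comp_iff)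
qed

lemma tc_Suc [comp_intros]: "total_computable g \<Longrightarrow> total_computable (\<lambda>x. Suc (g x))"
  by (rule tc_comp) (auto simp: total_computable_iff eval_Succ_iff intro: exI[of _ Succ])

lemma tc_p1 [comp_intros]: "total_computable g \<Longrightarrow> total_computable (\<lambda>x. p1 (g x))"
  by (rule tc_comp) (auto simp: total_computable_iff eval_Left_iff intro: exI[of _ Left])

lemma tc_p2 [comp_intros]: "total_computable g \<Longrightarrow> total_computable (\<lambda>x. p2 (g x))"
  by (rule tc_comp) (auto simp: total_computable_iff eval_Right_iff intro: exI[of _ Right])

lemma tc_pr [comp_intros]:
  assumes "total_computable h" "total_computable g"
  shows "total_computable (\<lambda>x. pr (h x) (g x))"
proof -
  from assms obtain h' g' where
    "\<forall>x y. eval h' x y \<longleftrightarrow> y = h x" "\<forall>x y. eval g' x y \<longleftrightarrow> y = g x"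
    by (auto simp: total_computable_iff)
  moreover have "p1 y = a \<and> p2 y = b \<longleftrightarrow> y = pr a b" for y a b
    by (metis fst_conv prod.collapse prod_decode_inverse prod_encode_inverse snd_conv)
  ultimately show ?thesis
    unfolding total_computable_iff by (intro exI[of _ "Pair h' g'"]) (simp add: eval_Pair_iff)
qed

lemma tc_const [comp_intros]: "total_computable (\<lambda>x. c)"
proof (induction c)
  case 0
  show ?case
    unfolding total_computable_iff by (rule exI[of _ Zero]) (simp add: eval_Zero_iff)
qed (rule tc_Suc)

text \<open>The step \<open>s\<close> receives the parameter, the counter and the previous value,
  nested in one number as \<open>Prec\<close> passes them. The premise \<open>eq\<close> allows the
  result to be stated in closed form.\<close>

lemma tc_primrec:
  assumes f: "total_computable f" and h: "total_computable h"
    and s: "total_computable (\<lambda>z. s (p1 z) (p1 (p2 z)) (p2 (p2 z)))"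
    and eq: "\<And>x. rec_nat (f x) (s x) (h x) = F x"
  shows "total_computable F"
proof -
  from f s obtain f' s' where
    f': "\<And>x y. eval f' x y \<longleftrightarrow> y = f x" and
    s': "\<And>x y. eval s' x y \<longleftrightarrow> y = s (p1 x) (p1 (p2 x)) (p2 (p2 x))"
    by (auto simp: total_computable_iff)
  have "eval (Prec f' s') (pr a n) y \<longleftrightarrow> y = rec_nat (f a) (s a) n" for a n y
    by (induction n arbitrary: y) (simp_all add: eval_Prec_0_iff eval_Prec_Suc_iff f' s')
  from this[of "p1 z" "p2 z" for z]
  have "total_computable (\<lambda>z. rec_nat (f (p1 z)) (s (p1 z)) (p2 z))"
    unfolding total_computable_iff by (intro exI[of _ "Prec f' s'"]) simp
  from tc_comp[OF this tc_pr[OF tc_ident h]] show ?thesis by (simp add: eq)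
qed

lemma tc_add [comp_intros]:
  assumes "total_computable f" "total_computable g"
  shows "total_computable (\<lambda>x. f x + g x)"
proof (rule tc_primrec[OF assms, of "\<lambda>_ _ y. Suc y"])
  have "rec_nat a (\<lambda>_ y. Suc y) n = a + n" for a n by (induction n) auto
  then show "rec_nat (f x) (\<lambda>_ y. Suc y) (g x) = f x + g x" for x .
qed (intro comp_intros)

lemma tc_mult [comp_intros]:
  assumes "total_computable f" "total_computable g"
  shows "total_computable (\<lambda>x. f x * g x)"
proof (rule tc_primrec[OF tc_const assms(2), of "\<lambda>x _ y. f x + y" 0])
  have "rec_nat 0 (\<lambda>_ y. a + y) n = a * n" for a n :: nat by (induction n) auto
  then show "rec_nat 0 (\<lambda>_ y. f x + y) (g x) = f x * g x" for x .
qed (intro comp_intros tc_comp[OF assms(1)])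

lemma tc_power [comp_intros]:
  assumes "total_computable f" "total_computable g"
  shows "total_computable (\<lambda>x. f x ^ g x)"
proof (rule tc_primrec[OF tc_const assms(2), of "\<lambda>x _ y. f x * y" 1])
  have "rec_nat 1 (\<lambda>_ y. a * y) n = a ^ n" for a n :: nat by (induction n) auto
  then show "rec_nat 1 (\<lambda>_ y. f x * y) (g x) = f x ^ g x" for x .
qed (intro comp_intros tc_comp[OF assms(1)])

lemma tc_pred:
  assumes "total_computable g"
  shows "total_computable (\<lambda>x. g x - 1)"
proof (rule tc_primrec[OF tc_const assms, of "\<lambda>_ n _. n" 0])
  show "rec_nat 0 (\<lambda>n y. n) (g x) = g x - 1" for x by (cases "g x") auto
qed (intro comp_intros)

lemma tc_diff [comp_intros]:
  assumes "total_computable f" "total_computable g"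
  shows "total_computable (\<lambda>x. f x - g x)"
proof (rule tc_primrec[OF assms, of "\<lambda>_ _ y. y - 1"])
  have "rec_nat a (\<lambda>_ y. y - 1) n = a - n" for a n :: nat by (induction n) auto
  then show "rec_nat (f x) (\<lambda>_ y. y - 1) (g x) = f x - g x" for x .
qed (intro comp_intros tc_pred)

lemma tc_parity [comp_intros]:
  assumes "total_computable g"
  shows "total_computable (\<lambda>x. g x mod 2)"
proof (rule tc_primrec[OF tc_const assms, of "\<lambda>_ _ y. 1 - y" 0])
  have "rec_nat 0 (\<lambda>_ y. 1 - y) n = n mod 2" for n :: nat
    by (induction n) (auto simp: mod_Suc)
  then show "rec_nat 0 (\<lambda>_ y. 1 - y) (g x) = g x mod 2" for x .
qed (intro comp_intros)

lemma tc_half [comp_intros]: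
  assumes "total_computable g"
  shows "total_computable (\<lambda>x. g x div 2)"
proof (rule tc_primrec[OF tc_const assms, of "\<lambda>_ n y. y + n mod 2" 0])
  have "rec_nat 0 (\<lambda>n y. y + n mod 2) n = n div 2" for n :: nat
  proof (induction n)
    case (Suc n)
    have "Suc n div 2 = n div 2 + n mod 2" by presburger
    with Suc show ?case by simp
  qed simp
  then show "rec_nat 0 (\<lambda>n y. y + n mod 2) (g x) = g x div 2" for x .
qed (intro comp_intros)

text \<open>Truth is coded by the value 0, so that sums and products express conjunction and
  disjunction, and \<open>Mu\<close> searches for a true instance.\<close>

definition dec :: "(nat \<Rightarrow> bool) \<Rightarrow> bool" where
  "dec P \<longleftrightarrow> (\<exists>h. total_computable h \<and> (\<forall>x. P x \<longleftrightarrow> h x = 0))"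

lemma dec_eq [comp_intros]:
  assumes "total_computable f" "total_computable g"
  shows "dec (\<lambda>x. f x = g x)"
  unfolding dec_def
  by (rule exI[of _ "\<lambda>x. (f x - g x) + (g x - f x)"]) (auto intro!: comp_intros assms)

lemma dec_le [comp_intros]:
  assumes "total_computable f" "total_computable g"
  shows "dec (\<lambda>x. f x \<le> g x)"
  unfolding dec_def
  by (rule exI[of _ "\<lambda>x. f x - g x"]) (auto intro!: comp_intros assms)

lemma dec_less [comp_intros]:
  assumes "total_computable f" "total_computable g"
  shows "dec (\<lambda>x. f x < g x)"
  unfolding dec_def
  by (rule exI[of _ "\<lambda>x. Suc (f x) - g x"]) (auto intro!: comp_intros assms)

lemma dec_conj [comp_intros]:
  assumes "dec P" "dec Q"
  shows "dec (\<lambda>x. P x \<and> Q x)"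
proof -
  from assms obtain f g where "total_computable f" "\<forall>x. P x \<longleftrightarrow> f x = 0"
    "total_computable g" "\<forall>x. Q x \<longleftrightarrow> g x = 0" by (auto simp: dec_def)
  then show ?thesis
    unfolding dec_def by (intro exI[of _ "\<lambda>x. f x + g x"]) (auto intro!: comp_intros)
qed

lemma dec_disj [comp_intros]:
  assumes "dec P" "dec Q"
  shows "dec (\<lambda>x. P x \<or> Q x)"
proof -
  from assms obtain f g where "total_computable f" "\<forall>x. P x \<longleftrightarrow> f x = 0"
    "total_computable g" "\<forall>x. Q x \<longleftrightarrow> g x = 0" by (auto simp: dec_def)
  then show ?thesis
    unfolding dec_def by (intro exI[of _ "\<lambda>x. f x * g x"]) (auto intro!: comp_intros)
qed

lemma dec_comp:
  assumes "dec P" "total_computable g"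
  shows "dec (\<lambda>x. P (g x))"
  using assms unfolding dec_def by (auto intro: tc_comp)

lemma dec_all_less:
  assumes "dec (\<lambda>z. P (p1 z) (p2 z))" "total_computable h"
  shows "dec (\<lambda>x. \<forall>i<h x. P x i)"
proof -
  from assms(1) obtain f where f: "total_computable f" "\<And>z. P (p1 z) (p2 z) \<longleftrightarrow> f z = 0"
    by (auto simp: dec_def)
  have P: "P x i \<longleftrightarrow> f (pr x i) = 0" for x i using f(2)[of "pr x i"] by simp
  have "rec_nat 0 (\<lambda>i y. y + f (pr x i)) n = 0 \<longleftrightarrow> (\<forall>i<n. P x i)" for x and n :: nat
    by (induction n) (auto simp: P less_Suc_eq)
  moreover have "total_computable (\<lambda>x. rec_nat 0 (\<lambda>i y. y + f (pr x i)) (h x))"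
    by (rule tc_primrec[OF tc_const assms(2) _ refl]) (intro comp_intros tc_comp[OF f(1)])
  ultimately show ?thesis unfolding dec_def by blast
qed

text \<open>A number is read as an endless stream of nested pairs. No length is stored; the range of
  relevant indices is always supplied from outside.\<close>

definition nth_pr :: "nat \<Rightarrow> nat \<Rightarrow> nat" where
  "nth_pr c i = p1 (rec_nat c (\<lambda>_. p2) i)"

lemma nth_pr_surj: "\<exists>c. \<forall>i<n. nth_pr c i = f i"
proof (induction n arbitrary: f)
  case (Suc n)
  obtain c where c: "\<forall>i<n. nth_pr c i = f (Suc i)" using Suc[of "\<lambda>i. f (Suc i)"] by auto
  have "rec_nat (pr (f 0) c) (\<lambda>_. p2) (Suc i) = rec_nat c (\<lambda>_. p2) i" for i
    by (induction i) auto
  with c have "\<forall>i<Suc n. nth_pr (pr (f 0) c) i = f i"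
    by (auto simp: nth_pr_def less_Suc_eq_0_disj)
  then show ?case ..
qed simp

lemma tc_nth_pr [comp_intros]:
  assumes "total_computable f" "total_computable g"
  shows "total_computable (\<lambda>x. nth_pr (f x) (g x))"
  unfolding nth_pr_def
  by (intro tc_p1, rule tc_primrec[OF assms, of "\<lambda>_ _. p2"]) (intro comp_intros refl)+

section \<open>Semidecidable predicates\<close>

definition semidec :: "(nat \<Rightarrow> bool) \<Rightarrow> bool" where
  "semidec P \<longleftrightarrow> (\<exists>D. dec (\<lambda>z. D (p1 z) (p2 z)) \<and> (\<forall>x. P x \<longleftrightarrow> (\<exists>t. D x t)))"

lemma dec_imp_semidec:
  assumes "dec P"
  shows "semidec P"
  unfolding semidec_def
  by (rule exI[of _ "\<lambda>x t. P x"]) (auto intro!: comp_intros dec_comp[OF assms])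

lemma semidec_comp:
  assumes "semidec P" "total_computable g"
  shows "semidec (\<lambda>x. P (g x))"
proof -
  from assms(1) obtain D where D: "dec (\<lambda>z. D (p1 z) (p2 z))" "\<forall>x. P x \<longleftrightarrow> (\<exists>t. D x t)"
    by (auto simp: semidec_def)
  have "dec (\<lambda>z. D (g (p1 z)) (p2 z))"
    using dec_comp[OF D(1), of "\<lambda>z. pr (g (p1 z)) (p2 z)"]
    by (simp add: comp_intros tc_comp[OF assms(2)])
  with D(2) show ?thesis unfolding semidec_def by (intro exI[of _ "\<lambda>x. D (g x)"]) auto
qed

lemma semidec_comp2:
  assumes "semidec (\<lambda>z. P (p1 z) (p2 z))" "total_computable f" "total_computable g"
  shows "semidec (\<lambda>x. P (f x) (g x))"
  using semidec_comp[OF assms(1) tc_pr[OF assms(2,3)]] by simp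

lemma semidec_conj:
  assumes "semidec P" "semidec Q"
  shows "semidec (\<lambda>x. P x \<and> Q x)"
proof -
  from assms obtain D E where
    D: "dec (\<lambda>z. D (p1 z) (p2 z))" "\<forall>x. P x \<longleftrightarrow> (\<exists>t. D x t)" and
    E: "dec (\<lambda>z. E (p1 z) (p2 z))" "\<forall>x. Q x \<longleftrightarrow> (\<exists>t. E x t)"
    by (auto simp: semidec_def)
  have "dec (\<lambda>z. D (p1 z) (p1 (p2 z)) \<and> E (p1 z) (p2 (p2 z)))"
    using dec_comp[OF D(1), of "\<lambda>z. pr (p1 z) (p1 (p2 z))"]
      dec_comp[OF E(1), of "\<lambda>z. pr (p1 z) (p2 (p2 z))"]
    by (simp add: comp_intros)
  moreover have "P x \<and> Q x \<longleftrightarrow> (\<exists>t. D x (p1 t) \<and> E x (p2 t))" for x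
    using D(2) E(2) by (metis fst_conv prod_encode_inverse snd_conv)
  ultimately show ?thesis
    unfolding semidec_def by (intro exI[of _ "\<lambda>x t. D x (p1 t) \<and> E x (p2 t)"]) auto
qed

lemma semidec_disj:
  assumes "semidec P" "semidec Q"
  shows "semidec (\<lambda>x. P x \<or> Q x)"
proof -
  from assms obtain D E where
    D: "dec (\<lambda>z. D (p1 z) (p2 z))" "\<forall>x. P x \<longleftrightarrow> (\<exists>t. D x t)" and
    E: "dec (\<lambda>z. E (p1 z) (p2 z))" "\<forall>x. Q x \<longleftrightarrow> (\<exists>t. E x t)"
    by (auto simp: semidec_def)
  then show ?thesis
    unfolding semidec_def by (intro exI[of _ "\<lambda>x t. D x t \<or> E x t"]) (auto intro: comp_intros)
qed

lemma semidec_ex: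
  assumes "semidec (\<lambda>z. P (p1 z) (p2 z))"
  shows "semidec (\<lambda>x. \<exists>y. P x y)"
proof -
  from assms obtain D where
    D: "dec (\<lambda>z. D (p1 z) (p2 z))" "\<And>z. P (p1 z) (p2 z) \<longleftrightarrow> (\<exists>t. D z t)"
    by (auto simp: semidec_def)
  have "dec (\<lambda>z. D (pr (p1 z) (p1 (p2 z))) (p2 (p2 z)))"
    using dec_comp[OF D(1), of "\<lambda>z. pr (pr (p1 z) (p1 (p2 z))) (p2 (p2 z))"]
    by (simp add: comp_intros)
  moreover have "(\<exists>y. P x y) \<longleftrightarrow> (\<exists>t. D (pr x (p1 t)) (p2 t))" for x
    using D(2)[of "pr x y" for y] by simp (metis fst_conv prod_encode_inverse snd_conv)
  ultimately show ?thesis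
    unfolding semidec_def by (intro exI[of _ "\<lambda>x t. D (pr x (p1 t)) (p2 t)"]) auto
qed

text \<open>The finitely many witnesses, one for each \<open>i\<close>, are collected into a single
  number by \<open>nth_pr\<close>.\<close>

lemma semidec_all_less:
  assumes "semidec (\<lambda>z. P (p1 z) (p2 z))" "total_computable h"
  shows "semidec (\<lambda>x. \<forall>i<h x. P x i)"
proof -
  from assms obtain D where
    D: "dec (\<lambda>z. D (p1 z) (p2 z))" "\<And>z. P (p1 z) (p2 z) \<longleftrightarrow> (\<exists>t. D z t)"
    by (auto simp: semidec_def)
  have "dec (\<lambda>z. D (pr (p1 (p1 z)) (p2 z)) (nth_pr (p2 (p1 z)) (p2 z)))"
    using dec_comp[OF D(1), of "\<lambda>z. pr (pr (p1 (p1 z)) (p2 z)) (nth_pr (p2 (p1 z)) (p2 z))"]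
    by (simp add: comp_intros)
  then have "dec (\<lambda>z. \<forall>i<h (p1 z). D (pr (p1 z) i) (nth_pr (p2 z) i))"
    by (rule dec_all_less) (intro comp_intros tc_comp[OF assms(2)])
  moreover have "(\<forall>i<h x. P x i) \<longleftrightarrow> (\<exists>t. \<forall>i<h x. D (pr x i) (nth_pr t i))" for x
  proof
    assume "\<forall>i<h x. P x i"
    then have "\<forall>i<h x. \<exists>t. D (pr x i) t" using D(2)[of "pr x i" for i] by simp
    then obtain t where "\<forall>i<h x. D (pr x i) (t i)" by metis
    with nth_pr_surj[of "h x" t] show "\<exists>t. \<forall>i<h x. D (pr x i) (nth_pr t i)" by metis
  qed (use D(2)[of "pr x i" for i] in auto)
  ultimately show ?thesis
    unfolding semidec_def by (intro exI[of _ "\<lambda>x t. \<forall>i<h x. D (pr x i) (nth_pr t i)"]) auto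
qed

text \<open>Effective uniformization: an unbounded search for a value paired with its witness halts
  everywhere by \<open>ex\<close>, and the first component of the result is the chosen
  value.\<close>

lemma semidec_choice:
  assumes "semidec (\<lambda>z. P (p1 z) (p2 z))" and ex: "\<And>x. \<exists>y. P x y"
  obtains \<alpha> where "total_computable \<alpha>" "\<And>x. P x (\<alpha> x)"
proof -
  from assms obtain D where
    D: "dec (\<lambda>z. D (p1 z) (p2 z))" "\<And>z. P (p1 z) (p2 z) \<longleftrightarrow> (\<exists>t. D z t)"
    by (auto simp: semidec_def)
  have "dec (\<lambda>z. D (pr (p1 z) (p1 (p2 z))) (p2 (p2 z)))"
    using dec_comp[OF D(1), of "\<lambda>z. pr (pr (p1 z) (p1 (p2 z))) (p2 (p2 z))"]
    by (simp add: comp_intros)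
  then obtain h where h: "total_computable h"
    "\<And>z. D (pr (p1 z) (p1 (p2 z))) (p2 (p2 z)) \<longleftrightarrow> h z = 0"
    by (auto simp: dec_def)
  have h': "D (pr x (p1 t)) (p2 t) \<longleftrightarrow> h (pr x t) = 0" for x t using h(2)[of "pr x t"] by simp
  have "\<exists>t. h (pr x t) = 0" for x
  proof -
    obtain y where "P x y" using ex by blast
    then obtain t where "D (pr x y) t" using D(2)[of "pr x y"] by auto
    then show ?thesis using h'[of x "pr y t"] by auto
  qed
  then have L: "h (pr x (LEAST t. h (pr x t) = 0)) = 0" for x by (rule LeastI_ex)
  from h(1) obtain f where f: "\<And>x y. eval f x y \<longleftrightarrow> y = h x" by (auto simp: total_computable_iff)
  have "eval (Mu f) x t \<longleftrightarrow> t = (LEAST t. h (pr x t) = 0)" for x t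
    using L[of x] unfolding eval_Mu_iff f
    by (auto dest: not_less_Least intro!: Least_equality[symmetric] leI)
  then have "total_computable (\<lambda>x. LEAST t. h (pr x t) = 0)" unfolding total_computable_iff by blast
  then have "total_computable (\<lambda>x. p1 (LEAST t. h (pr x t) = 0))" by (rule tc_p1)
  moreover have "P x (p1 (LEAST t. h (pr x t) = 0))" for x
    using L[of x] D(2)[of "pr x y" for y] h'[of x] by auto
  ultimately show ?thesis using that by blast
qed

text \<open>The recursion is unrolled into a coded list of its intermediate values, a form covered
  by the closure rules for \<open>semidec\<close>.\<close>

lemma eval_Prec_iff:
  "eval (Prec f g) x y \<longleftrightarrow>
     (\<exists>c. eval f (p1 x) (nth_pr c 0) \<and>
        (\<forall>i<p2 x. eval g (pr (p1 x) (pr i (nth_pr c i))) (nth_pr c (Suc i))) \<and>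
        nth_pr c (p2 x) = y)"
proof -
  have "eval (Prec f g) (pr a n) y \<longleftrightarrow>
     (\<exists>v. eval f a (v 0) \<and> (\<forall>i<n. eval g (pr a (pr i (v i))) (v (Suc i))) \<and> v n = y)" for a n
  proof (induction n arbitrary: y)
    case 0
    show ?case by (auto simp: eval_Prec_0_iff)
  next
    case (Suc n)
    show ?case
    proof
      assume "eval (Prec f g) (pr a (Suc n)) y"
      then obtain v where "eval f a (v 0)" "\<forall>i<n. eval g (pr a (pr i (v i))) (v (Suc i))"
        "eval g (pr a (pr n (v n))) y"
        by (auto simp: eval_Prec_Suc_iff Suc)
      then show "\<exists>v. eval f a (v 0) \<and>
          (\<forall>i<Suc n. eval g (pr a (pr i (v i))) (v (Suc i))) \<and> v (Suc n) = y"
        by (intro exI[of _ "v(Suc n := y)"]) (auto simp: less_Suc_eq)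
    next
      assume "\<exists>v. eval f a (v 0) \<and>
          (\<forall>i<Suc n. eval g (pr a (pr i (v i))) (v (Suc i))) \<and> v (Suc n) = y"
      then obtain v where "eval f a (v 0)" "\<forall>i<Suc n. eval g (pr a (pr i (v i))) (v (Suc i))"
        "v (Suc n) = y" by blast
      then show "eval (Prec f g) (pr a (Suc n)) y"
        unfolding eval_Prec_Suc_iff Suc by (intro exI[of _ "v n"]) auto
    qed
  qed
  from this[of "p1 x" "p2 x"] have *: "eval (Prec f g) x y \<longleftrightarrow>
     (\<exists>v. eval f (p1 x) (v 0) \<and> (\<forall>i<p2 x. eval g (pr (p1 x) (pr i (v i))) (v (Suc i))) \<and>
        v (p2 x) = y)" by simp
  show ?thesis
  proof
    assume "eval (Prec f g) x y"
    then obtain v where v: "eval f (p1 x) (v 0)" "v (p2 x) = y"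
      "\<forall>i<p2 x. eval g (pr (p1 x) (pr i (v i))) (v (Suc i))" unfolding * by blast
    obtain c where "\<forall>i<Suc (p2 x). nth_pr c i = v i" using nth_pr_surj by blast
    with v show "\<exists>c. eval f (p1 x) (nth_pr c 0) \<and>
        (\<forall>i<p2 x. eval g (pr (p1 x) (pr i (nth_pr c i))) (nth_pr c (Suc i))) \<and>
        nth_pr c (p2 x) = y" by (intro exI[of _ c]) auto
  qed (unfold *, blast)
qed

text \<open>Graphs of partial computable functions are computably enumerable; this later allows the
  outputs of \<open>U\<close> to be enumerated.\<close>

lemma semidec_eval: "semidec (\<lambda>z. eval f (p1 z) (p2 z))"
proof (induction f)
  case (Pair f g)
  show ?case unfolding eval_Pair_iff
    by (intro semidec_conj semidec_comp2[OF Pair(1)] semidec_comp2[OF Pair(2)] comp_intros)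
next
  case (Comp f g)
  show ?case unfolding eval_Comp_iff
    by (intro semidec_ex semidec_conj semidec_comp2[OF Comp(1)] semidec_comp2[OF Comp(2)]
        comp_intros)
next
  case (Prec f g)
  show ?case unfolding eval_Prec_iff
    by (intro semidec_ex semidec_conj semidec_all_less semidec_comp2[OF Prec(1)]
        semidec_comp2[OF Prec(2)] dec_imp_semidec comp_intros)
next
  case (Mu f)
  show ?case unfolding eval_Mu_iff
    by (intro semidec_ex semidec_conj semidec_all_less semidec_comp2[OF Mu]
        dec_imp_semidec comp_intros)
qed (unfold eval_Zero_iff eval_Succ_iff eval_Ident_iff eval_Left_iff eval_Right_iff,
     (intro dec_imp_semidec comp_intros)+)

section \<open>Computing a point from a shrinking sequence of nearly finite sets\<close>

lemma nat_int_decode: "nat (int_decode v) = v div 2 * (1 - v mod 2)"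
  \<comment> \<open>Nonnegative integers have even codes and negative ones odd codes, so the last
    factor truncates at 0.\<close>
  by (auto simp: int_decode_def sum_decode_def elim!: evenE oddE)

text \<open>Cutting negative approximations off at 0 keeps the error bound, since distances are
  nonnegative. The numerators can then be handled by arithmetic on natural numbers.\<close>

lemma computable_metric_space_approx:
  assumes "computable_metric_space q"
  obtains g where "total_computable g"
    "\<And>i k s. \<bar>dist (q i) (q k) - real (g (pr i (pr k s))) / 2 ^ s\<bar> \<le> 1 / 2 ^ s"
proof -
  from assms obtain f where f: "total_computable f"
    "\<And>i k s. \<bar>dist (q i) (q k) - real_of_int (int_decode (f (pr i (pr k s)))) / 2 ^ s\<bar> \<le> 1 / 2 ^ s"
    unfolding computable_metric_space_def by blast
  define g where "g = (\<lambda>z. nat (int_decode (f z)))"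
  have "total_computable g"
    unfolding g_def nat_int_decode by (intro comp_intros f(1))
  moreover have "\<bar>dist (q i) (q k) - real (g (pr i (pr k s))) / 2 ^ s\<bar> \<le> 1 / 2 ^ s" for i k s
  proof (cases "int_decode (f (pr i (pr k s))) \<ge> 0")
    case True
    then show ?thesis using f(2)[of i k s] by (simp add: g_def)
  next
    case False
    then have "real_of_int (int_decode (f (pr i (pr k s)))) / 2 ^ s \<le> 0"
      by (simp add: divide_nonpos_pos)
    moreover have "g (pr i (pr k s)) = 0" using False by (simp add: g_def)
    ultimately show ?thesis
      using f(2)[of i k s] zero_le_dist[of "q i" "q k"] by (simp only: of_nat_0 div_0)
  qed
  ultimately show ?thesis using that by blast
qed

lemma ex_inverse_power2_less: "0 < d \<Longrightarrow> \<exists>s. a / 2 ^ s < (d::real)"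
proof -
  assume "0 < d"
  obtain s where "a / d < 2 ^ s" using real_arch_pow[of 2 "a / d"] by auto
  then have "a / 2 ^ s < d" using \<open>0 < d\<close> by (simp add: field_simps)
  then show ?thesis ..
qed

text \<open>A strict inequality is witnessed by a precision \<open>s\<close> at which the
  approximation plus its error already lies below the bound. Clearing denominators makes this a
  comparison of natural numbers.\<close>

lemma semidec_dist_less:
  assumes q: "computable_metric_space q"
    and "total_computable f" "total_computable h" "total_computable c" "total_computable e"
  shows "semidec (\<lambda>x. dist (q (f x)) (q (h x)) < real (c x) / 2 ^ e x)"
proof -
  obtain g where g: "total_computable g"
    "\<And>i k s. \<bar>dist (q i) (q k) - real (g (pr i (pr k s))) / 2 ^ s\<bar> \<le> 1 / 2 ^ s"
    using computable_metric_space_approx[OF q] by blast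
  have "dist (q i) (q k) < real a / 2 ^ l \<longleftrightarrow>
    (\<exists>s. (g (pr i (pr k s)) + 1) * 2 ^ l < a * 2 ^ s)" for i k a l
  proof -
    have *: "(g (pr i (pr k s)) + 1) * 2 ^ l < a * 2 ^ s \<longleftrightarrow>
      real (g (pr i (pr k s))) / 2 ^ s + 1 / 2 ^ s < real a / 2 ^ l" for s
    proof -
      have "(g (pr i (pr k s)) + 1) * 2 ^ l < a * 2 ^ s \<longleftrightarrow>
        real ((g (pr i (pr k s)) + 1) * 2 ^ l) < real (a * 2 ^ s)"
        by (simp only: of_nat_less_iff)
      then show ?thesis by (simp add: field_simps)
    qed
    show ?thesis
    proof
      assume "dist (q i) (q k) < real a / 2 ^ l"
      then obtain s where "2 / 2 ^ s < real a / 2 ^ l - dist (q i) (q k)"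
        using ex_inverse_power2_less[of "real a / 2 ^ l - dist (q i) (q k)" 2] by auto
      with g(2)[of i k s] show "\<exists>s. (g (pr i (pr k s)) + 1) * 2 ^ l < a * 2 ^ s"
        unfolding * by (intro exI[of _ s]) simp
    next
      assume "\<exists>s. (g (pr i (pr k s)) + 1) * 2 ^ l < a * 2 ^ s"
      then obtain s where "real (g (pr i (pr k s))) / 2 ^ s + 1 / 2 ^ s < real a / 2 ^ l"
        unfolding * by blast
      with g(2)[of i k s] show "dist (q i) (q k) < real a / 2 ^ l" by linarith
    qed
  qed
  then show ?thesis
    by (simp only:) (intro semidec_ex dec_imp_semidec comp_intros tc_comp[OF g(1)]
      tc_comp[OF assms(2)] tc_comp[OF assms(3)] tc_comp[OF assms(4)] tc_comp[OF assms(5)])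
qed

lemma semidec_less_dist:
  assumes q: "computable_metric_space q"
    and "total_computable f" "total_computable h" "total_computable c" "total_computable e"
  shows "semidec (\<lambda>x. real (c x) / 2 ^ e x < dist (q (f x)) (q (h x)))"
proof -
  obtain g where g: "total_computable g"
    "\<And>i k s. \<bar>dist (q i) (q k) - real (g (pr i (pr k s))) / 2 ^ s\<bar> \<le> 1 / 2 ^ s"
    using computable_metric_space_approx[OF q] by blast
  have "real a / 2 ^ l < dist (q i) (q k) \<longleftrightarrow>
    (\<exists>s. a * 2 ^ s + 2 ^ l < g (pr i (pr k s)) * 2 ^ l)" for i k a l
  proof -
    \<comment> \<open>The error is added on the left rather than subtracted on the right, where
      subtraction of natural numbers would truncate.\<close>
    have *: "a * 2 ^ s + 2 ^ l < g (pr i (pr k s)) * 2 ^ l \<longleftrightarrow>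
      real a / 2 ^ l + 1 / 2 ^ s < real (g (pr i (pr k s))) / 2 ^ s" for s
    proof -
      have "a * 2 ^ s + 2 ^ l < g (pr i (pr k s)) * 2 ^ l \<longleftrightarrow>
        real (a * 2 ^ s + 2 ^ l) < real (g (pr i (pr k s)) * 2 ^ l)"
        by (simp only: of_nat_less_iff)
      also have "\<dots> \<longleftrightarrow> real a / 2 ^ l < (real (g (pr i (pr k s))) - 1) / 2 ^ s"
        by (simp add: field_simps)
      finally show ?thesis by (simp add: diff_divide_distrib less_diff_eq)
    qed
    show ?thesis
    proof
      assume "real a / 2 ^ l < dist (q i) (q k)"
      then obtain s where "2 / 2 ^ s < dist (q i) (q k) - real a / 2 ^ l"
        using ex_inverse_power2_less[of "dist (q i) (q k) - real a / 2 ^ l" 2] by auto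
      with g(2)[of i k s] show "\<exists>s. a * 2 ^ s + 2 ^ l < g (pr i (pr k s)) * 2 ^ l"
        unfolding * by (intro exI[of _ s]) simp
    next
      assume "\<exists>s. a * 2 ^ s + 2 ^ l < g (pr i (pr k s)) * 2 ^ l"
      then obtain s where "real a / 2 ^ l + 1 / 2 ^ s < real (g (pr i (pr k s))) / 2 ^ s"
        unfolding * by blast
      with g(2)[of i k s] show "real a / 2 ^ l < dist (q i) (q k)" by linarith
    qed
  qed
  then show ?thesis
    by (simp only:) (intro semidec_ex dec_imp_semidec comp_intros tc_comp[OF g(1)]
      tc_comp[OF assms(2)] tc_comp[OF assms(3)] tc_comp[OF assms(4)] tc_comp[OF assms(5)])
qed

text \<open>An indexed family is used instead of a set so that coded families
  \<open>nth_pr f\<close> fit directly. Pairs with \<open>j < i\<close> suffice by symmetry.\<close>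

definition separated :: "('b \<Rightarrow> 'a::metric_space) \<Rightarrow> 'b set \<Rightarrow> real \<Rightarrow> nat \<Rightarrow> (nat \<Rightarrow> 'b) \<Rightarrow> bool" where
  "separated q A d w f \<longleftrightarrow>
     (\<forall>i<w. f i \<in> A) \<and> (\<forall>i<w. \<forall>j<i. d < dist (q (f i)) (q (f j)))"

lemma separated_Suc:
  assumes "separated q A d w f" "p \<in> A" "\<And>j. j < w \<Longrightarrow> d < dist (q p) (q (f j))"
  shows "separated q A d (Suc w) (f(w := p))"
  using assms by (auto simp: separated_def less_Suc_eq)

text \<open>Otherwise every \<open>A k\<close> has points in annuli of ever smaller radii around \<open>x\<close>, and points
  from different annuli are separated.\<close>

lemma isolated_if_not_separated:
  assumes "\<And>k f. \<not> separated q (A k) (4 / 2 ^ k) (Suc N) f"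
  obtains r where "0 < r"
    "\<And>d. 0 < d \<Longrightarrow> \<exists>k. \<forall>p\<in>A k. dist x (q p) \<le> r \<longrightarrow> dist x (q p) < d"
proof (rule ccontr)
  assume "\<not> thesis"
  then have neg: "0 < r \<Longrightarrow> \<exists>d>0. \<forall>k. \<exists>p\<in>A k. dist x (q p) \<le> r \<and> d \<le> dist x (q p)" for r
    using that[of r] by (meson not_le_imp_less)
  \<comment> \<open>Here \<open>d\<close> is chosen before \<open>k\<close>: one separation serves
    all the sets \<open>A k\<close> at once.\<close>
  have "\<exists>d>0. \<forall>k. \<exists>f. separated q (A k) (d / 2) m f \<and> (\<forall>i<m. d \<le> dist x (q (f i)))" for m
  proof (induction m)
    case 0
    show ?case by (auto simp: separated_def intro: exI[of _ 1])
  next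
    case (Suc m)
    then obtain d where d: "d > 0"
      "\<And>k. \<exists>f. separated q (A k) (d / 2) m f \<and> (\<forall>i<m. d \<le> dist x (q (f i)))" by blast
    from neg[of "d / 2"] d(1) obtain d' where d': "d' > 0"
      "\<And>k. \<exists>p\<in>A k. dist x (q p) \<le> d / 2 \<and> d' \<le> dist x (q p)" by auto
    have "\<exists>f. separated q (A k) (min d d' / 2 / 2) (Suc m) f \<and>
        (\<forall>i<Suc m. min d d' / 2 \<le> dist x (q (f i)))" for k
    proof -
      obtain f where f: "separated q (A k) (d / 2) m f" "\<forall>i<m. d \<le> dist x (q (f i))"
        using d(2) by blast
      obtain p where p: "p \<in> A k" "dist x (q p) \<le> d / 2" "d' \<le> dist x (q p)"
        using d'(2) by blast
      \<comment> \<open>The old points are at least \<open>d\<close> from \<open>x\<close> and the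
        new one at most \<open>d / 2\<close>, so they are at least \<open>d / 2\<close> apart; the
        extra halving makes the inequality strict.\<close>
      have le: "min d d' / 2 / 2 < d / 2" using d(1) d'(1) by simp
      have "separated q (A k) (min d d' / 2 / 2) m f"
        using f(1) le unfolding separated_def by (meson less_trans)
      moreover have "min d d' / 2 / 2 < dist (q p) (q (f j))" if "j < m" for j
      proof -
        have "d \<le> dist x (q (f j))" using f(2) that by blast
        with p(2) le show ?thesis using dist_triangle[of x "q (f j)" "q p"] by linarith
      qed
      ultimately have "separated q (A k) (min d d' / 2 / 2) (Suc m) (f(m := p))"
        using p(1) by (intro separated_Suc)
      moreover have "\<forall>i<Suc m. min d d' / 2 \<le> dist x (q ((f(m := p)) i))"
        using f(2) p(3) d(1) d'(1) by (auto simp: less_Suc_eq min_def)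
      ultimately show ?thesis by blast
    qed
    with d(1) d'(1) show ?case by (intro exI[of _ "min d d' / 2"]) auto
  qed
  then obtain d where d: "d > 0" "\<And>k. \<exists>f. separated q (A k) (d / 2) (Suc N) f" by meson
  \<comment> \<open>The separation stays fixed while \<open>4 / 2 ^ k\<close> tends to 0, so some
    \<open>A k\<close> violates the assumption.\<close>
  obtain k where k: "4 / 2 ^ k < d / 2" using ex_inverse_power2_less[of "d / 2" 4] d(1) by auto
  obtain f where "separated q (A k) (d / 2) (Suc N) f" using d(2) by blast
  with k have "separated q (A k) (4 / 2 ^ k) (Suc N) f"
    unfolding separated_def by (meson less_trans)
  with assms show False by blast
qed

text \<open>The numbers \<open>e\<close>, \<open>c\<close>, \<open>w\<close> and \<open>k0\<close>
  found in the proof need only exist: they are finite information built into the algorithm, not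
  computed from \<open>x\<close>.\<close>

lemma computable_point_of_semidec_sets:
  fixes q :: "nat \<Rightarrow> 'a::complete_space"
  assumes q: "computable_metric_space q"
    and A: "semidec (\<lambda>z. p1 z \<in> A (p2 z))" "decseq A"
    and near: "\<And>k p. dist x (q p) < 1 / 2 ^ (2 * k + 2) \<Longrightarrow> p \<in> A k"
    and nsep: "\<And>k f. \<not> separated q (A k) (4 / 2 ^ k) (Suc N) f"
  shows "computable_point q x"
proof -
  have dense: "\<exists>p. dist x (q p) < d" if "0 < d" for d
  proof -
    have "x \<in> closure (range q)" using q by (simp add: computable_metric_space_def)
    with that show ?thesis by (auto simp: closure_approachable dist_commute)
  qed
  obtain r where r: "0 < r"
    "\<And>d. 0 < d \<Longrightarrow> \<exists>k. \<forall>p\<in>A k. dist x (q p) \<le> r \<longrightarrow> dist x (q p) < d"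
    using isolated_if_not_separated[OF nsep] by blast
  \<comment> \<open>Points within \<open>1 / 2 ^ e\<close> of \<open>c\<close> are then within
    \<open>r\<close> of \<open>x\<close>, where isolation applies.\<close>
  obtain e where e: "2 / 2 ^ e < r" using ex_inverse_power2_less[OF r(1), of 2] by blast
  obtain c where c: "dist x (q c) < 1 / 2 ^ Suc e" using dense[of "1 / 2 ^ Suc e"] by auto
  \<comment> \<open>That \<open>W w\<close> holds gives arbitrarily late families of size
    \<open>w\<close>; that \<open>W (Suc w)\<close> fails gives the bound \<open>k0\<close> beyond
    which none is larger.\<close>
  define W where "W w \<longleftrightarrow> (\<exists>\<^sub>\<infinity>k. \<exists>f. separated q (A k) (4 / 2 ^ k) w f)" for w
  have "W 0" by (simp add: W_def separated_def)
  have W_le: "w \<le> N" if "W w" for w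
  proof (rule ccontr)
    assume "\<not> w \<le> N"
    from \<open>W w\<close> obtain k f where "separated q (A k) (4 / 2 ^ k) w f"
      unfolding W_def INFM_nat by blast
    with \<open>\<not> w \<le> N\<close> have "separated q (A k) (4 / 2 ^ k) (Suc N) f" by (auto simp: separated_def)
    with nsep show False by blast
  qed
  define w where "w = Greatest W"
  have "W w" unfolding w_def by (rule GreatestI_nat[of W 0, OF \<open>W 0\<close> W_le])
  have "\<not> W (Suc w)" using Greatest_le_nat[of W "Suc w" N] W_le by (auto simp: w_def)
  then obtain k0 where k0: "\<And>k f. k0 < k \<Longrightarrow> \<not> separated q (A k) (4 / 2 ^ k) (Suc w) f"
    unfolding W_def INFM_nat by blast
  \<comment> \<open>A special point very near \<open>x\<close> belongs to \<open>A k\<close>; if it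
    were far from all members, it would extend the family to size \<open>Suc w\<close>.\<close>
  have close: "\<exists>i<w. dist x (q (f i)) < 5 / 2 ^ k"
    if "k0 < k" and f: "separated q (A k) (4 / 2 ^ k) w f" for k f
  proof -
    obtain p where p: "dist x (q p) < 1 / 2 ^ (2 * k + 2)"
      using dense[of "1 / 2 ^ (2 * k + 2)"] by auto
    have "\<exists>i<w. dist (q p) (q (f i)) \<le> 4 / 2 ^ k"
      using separated_Suc[OF f near[OF p]] k0[OF \<open>k0 < k\<close>] by (meson not_le_imp_less)
    then obtain i where i: "i < w" "dist (q p) (q (f i)) \<le> 4 / 2 ^ k" by blast
    have "(1::real) / 2 ^ (2 * k + 2) \<le> 1 / 2 ^ k"
      by (intro divide_left_mono power_increasing) auto
    then have "dist x (q (f i)) < 1 / 2 ^ k + 4 / 2 ^ k"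
      using p i(2) dist_triangle[of x "q (f i)" "q p"] by linarith
    with i(1) show ?thesis by (auto simp: add_divide_distrib[symmetric])
  qed
  \<comment> \<open>The offset 4 comes from \<open>5 / 16 < 1 / 2\<close>.\<close>
  have small: "(5::real) / 2 ^ k < 1 / 2 ^ Suc e" "(5::real) / 2 ^ k \<le> 5 / 2 ^ s"
    if "e + 4 + s \<le> k" for k s
  proof -
    have "(5::real) / 2 ^ k \<le> 5 / 2 ^ (e + 4)" using that by (intro divide_left_mono power_increasing) auto
    also have "\<dots> < 1 / 2 ^ Suc e" by (simp add: field_simps power_add)
    finally show "(5::real) / 2 ^ k < 1 / 2 ^ Suc e" .
    show "(5::real) / 2 ^ k \<le> 5 / 2 ^ s" using that by (intro divide_left_mono power_increasing) auto
  qed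
  have Suc_e: "1 / 2 ^ Suc e + 1 / 2 ^ Suc e = (1::real) / 2 ^ e" by simp
  \<comment> \<open>A ball around the special point \<open>c\<close> is used because \<open>x\<close> itself is not given effectively.\<close>
  define R where "R s y \<longleftrightarrow> (\<exists>k f. k0 + e + 5 + s \<le> k \<and>
      (\<forall>i<w. nth_pr f i \<in> A k) \<and>
      (\<forall>i<w. \<forall>j<i. real 4 / 2 ^ k < dist (q (nth_pr f i)) (q (nth_pr f j))) \<and>
      (\<forall>i<w. real 1 / 2 ^ e < dist (q (nth_pr f i)) (q c) \<or>
         dist (q (nth_pr f i)) (q y) < real 1 / 2 ^ s))" for s y
  have "semidec (\<lambda>z. R (p1 z) (p2 z))"
    unfolding R_def
    by (intro semidec_ex semidec_conj semidec_disj semidec_all_less semidec_comp2[OF A(1)]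
        semidec_dist_less[OF q] semidec_less_dist[OF q]; (rule dec_imp_semidec)?; intro comp_intros)
  moreover have "\<exists>y. R s y" for s
  proof -
    \<comment> \<open>Isolation supplies \<open>k1\<close>, and every later \<open>A k\<close>
      inherits the property because \<open>A\<close> is decreasing.\<close>
    obtain k1 where k1: "\<And>p. p \<in> A k1 \<Longrightarrow> dist x (q p) \<le> r \<Longrightarrow> dist x (q p) < 1 / 2 ^ Suc s"
      using r(2)[of "1 / 2 ^ Suc s"] by auto
    obtain k f' where k: "k1 + k0 + e + 5 + s < k" and "separated q (A k) (4 / 2 ^ k) w f'"
      using \<open>W w\<close> unfolding W_def INFM_nat by blast
    moreover obtain f where "\<forall>i<w. nth_pr f i = f' i" using nth_pr_surj by blast
    ultimately have f: "separated q (A k) (4 / 2 ^ k) w (nth_pr f)" by (simp add: separated_def)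
    obtain i where i: "i < w" "dist x (q (nth_pr f i)) < 5 / 2 ^ k"
      using close[OF _ f] k by auto
    have sm: "dist x (q (nth_pr f j)) < 1 / 2 ^ Suc s"
      if "j < w" "dist (q (nth_pr f j)) (q c) \<le> 1 / 2 ^ e" for j
    proof (rule k1)
      have "A k \<subseteq> A k1" using k by (intro decseqD[OF A(2)]) simp
      then show "nth_pr f j \<in> A k1" using f that(1) by (auto simp: separated_def)
      have "dist x (q (nth_pr f j)) \<le> dist x (q c) + dist (q (nth_pr f j)) (q c)"
        by (rule dist_triangle2)
      also have "\<dots> \<le> 1 / 2 ^ e + 1 / 2 ^ e"
        using that(2) c Suc_e zero_le_dist[of x "q c"] by linarith
      also have "\<dots> = 2 / 2 ^ e" by simp
      finally show "dist x (q (nth_pr f j)) \<le> r" using e by simp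
    qed
    \<comment> \<open>The member close to \<open>x\<close> lies in the ball around \<open>c\<close>;
      it is the value \<open>y\<close> for which \<open>R s y\<close> is shown.\<close>
    have "dist (q (nth_pr f i)) (q c) \<le> 1 / 2 ^ e"
      using i(2) c small(1)[of s k] k Suc_e dist_triangle3[of "q (nth_pr f i)" "q c" x] by linarith
    then have "dist x (q (nth_pr f i)) < 1 / 2 ^ Suc s" using sm i(1) by blast
    moreover have "1 / 2 ^ Suc s + 1 / 2 ^ Suc s = (1::real) / 2 ^ s" by simp
    ultimately have "dist (q (nth_pr f j)) (q (nth_pr f i)) < 1 / 2 ^ s"
      if "j < w" "dist (q (nth_pr f j)) (q c) \<le> 1 / 2 ^ e" for j
      using sm[OF that] dist_triangle3[of "q (nth_pr f j)" "q (nth_pr f i)" x] by linarith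
    then have "\<forall>j<w. real 1 / 2 ^ e < dist (q (nth_pr f j)) (q c) \<or>
        dist (q (nth_pr f j)) (q (nth_pr f i)) < real 1 / 2 ^ s"
      unfolding of_nat_1 by (meson not_le_imp_less)
    moreover have "k0 + e + 5 + s \<le> k" using k by simp
    ultimately have "R s (nth_pr f i)"
      using f unfolding R_def separated_def of_nat_numeral by blast
    then show ?thesis ..
  qed
  ultimately obtain \<alpha> where \<alpha>: "total_computable \<alpha>" "\<And>s. R s (\<alpha> s)"
    by (rule semidec_choice[of R]) (rule that)
  \<comment> \<open>Whatever \<open>k\<close> and \<open>f\<close> the search finds, the member near
    \<open>x\<close> lies in the ball around \<open>c\<close>, so the disjunction in
    \<open>R\<close> forces it to be close to \<open>y\<close>.\<close>
  have R: "dist x (q y) < 6 / 2 ^ s" if "R s y" for s y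
  proof -
    from that obtain k f where k: "k0 + e + 5 + s \<le> k" and f: "separated q (A k) (4 / 2 ^ k) w (nth_pr f)"
      and y: "\<forall>i<w. 1 / 2 ^ e < dist (q (nth_pr f i)) (q c) \<or> dist (q (nth_pr f i)) (q y) < 1 / 2 ^ s"
      unfolding R_def separated_def of_nat_1 of_nat_numeral by blast
    obtain i where i: "i < w" "dist x (q (nth_pr f i)) < 5 / 2 ^ k"
      using close[OF _ f] k by auto
    have "dist (q (nth_pr f i)) (q c) \<le> 1 / 2 ^ e"
      using i(2) c small(1)[of s k] k Suc_e dist_triangle3[of "q (nth_pr f i)" "q c" x] by linarith
    with y i(1) have "dist (q (nth_pr f i)) (q y) < 1 / 2 ^ s" by force
    then have "dist x (q y) < 5 / 2 ^ s + 1 / 2 ^ s"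
      using i(2) small(2)[of s k] k dist_triangle[of x "q y" "q (nth_pr f i)"] by linarith
    then show ?thesis by (simp add: add_divide_distrib[symmetric])
  qed
  \<comment> \<open>The shift by 4 uses \<open>6 / 16 < 1 / 2\<close>; two such errors then add up
    to at most \<open>1 / 2 ^ s\<close>.\<close>
  have near_\<alpha>: "dist x (q (\<alpha> (s + 4))) < 1 / 2 ^ Suc s" for s
    using R[OF \<alpha>(2)[of "s + 4"]] by (rule less_trans) (simp add: field_simps power_add)
  show ?thesis
    unfolding computable_point_def
  proof (intro exI[of _ "\<lambda>s. \<alpha> (s + 4)"] conjI allI impI)
    show "total_computable (\<lambda>s. \<alpha> (s + 4))" by (intro tc_comp[OF \<alpha>(1)] comp_intros)
  next
    fix s t :: nat
    assume "s \<le> t"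
    then have "(1::real) / 2 ^ Suc t \<le> 1 / 2 ^ Suc s" by (intro divide_left_mono power_increasing) auto
    moreover have "1 / 2 ^ Suc s + 1 / 2 ^ Suc s = (1::real) / 2 ^ s" by simp
    ultimately show "dist (q (\<alpha> (s + 4))) (q (\<alpha> (t + 4))) \<le> 1 / 2 ^ s"
      using near_\<alpha>[of s] near_\<alpha>[of t] dist_triangle3[of "q (\<alpha> (s + 4))" "q (\<alpha> (t + 4))" x]
      by linarith
  next
    show "(\<lambda>s. q (\<alpha> (s + 4))) \<longlonglongrightarrow> x"
    proof (rule metric_LIMSEQ_I)
      fix d :: real
      assume "0 < d"
      then obtain n where n: "1 / 2 ^ n < d" using ex_inverse_power2_less by blast
      have "dist (q (\<alpha> (s + 4))) x < d" if "n \<le> s" for s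
      proof -
        have "(1::real) / 2 ^ Suc s \<le> 1 / 2 ^ n" using that by (intro divide_left_mono power_increasing) auto
        with near_\<alpha>[of s] n show ?thesis by (simp add: dist_commute)
      qed
      then show "\<exists>n. \<forall>s\<ge>n. dist (q (\<alpha> (s + 4))) x < d" by blast
    qed
  qed
qed

section \<open>Short descriptions\<close>

text \<open>These bounds translate lengths of programs into numerical bounds on their codes.\<close>

lemma slen_bounds: "2 ^ slen n \<le> n + 1" "n + 1 < 2 ^ (slen n + 1)"
proof -
  define l where "l = log 2 (real (n + 1))"
  have l: "0 \<le> l" by (simp add: l_def)
  have "real (n + 1) = 2 powr l" by (simp add: l_def)
  moreover have "real (slen n) \<le> l" "l < real (slen n + 1)"
    using l unfolding slen_def l_def[symmetric] by linarith+
  ultimately have "2 powr real (slen n) \<le> real (n + 1)" "real (n + 1) < 2 powr real (slen n + 1)"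
    by (simp_all del: of_nat_add)
  then have "real (2 ^ slen n) \<le> real (n + 1)" "real (n + 1) < real (2 ^ (slen n + 1))"
    unfolding powr_realpow[OF zero_less_numeral] by simp_all
  then show "2 ^ slen n \<le> n + 1" "n + 1 < 2 ^ (slen n + 1)"
    by (simp_all only: of_nat_le_iff of_nat_less_iff)
qed

text \<open>Comparison with the identity machine. In particular every number has a program, so the
  minimum defining \<open>KC\<close> is attained.\<close>

lemma optimal_machine_program_length:
  assumes "optimal_machine U"
  obtains c where "\<And>x. \<exists>\<tau>. U \<tau> = Some x \<and> slen \<tau> \<le> slen x + c"
proof -
  have "partial_computable Some"
    using tc_ident unfolding total_computable_def .
  with assms show ?thesis using that unfolding optimal_machine_def by blast
qed

lemma KC_le: "U \<sigma> = Some x \<Longrightarrow> KC U x \<le> slen \<sigma>"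
  unfolding KC_def by (rule Least_le) auto

lemma KC_attained:
  assumes "optimal_machine U"
  obtains \<sigma> where "U \<sigma> = Some x" "slen \<sigma> = KC U x"
proof -
  have "\<exists>k \<sigma>. slen \<sigma> = k \<and> U \<sigma> = Some x"
    using optimal_machine_program_length[OF assms] by metis
  from LeastI_ex[OF this] that show ?thesis unfolding KC_def by blast
qed

text \<open>A program for \<open>n\<close> also yields a good approximation paired with
  \<open>n\<close>: the machine \<open>V\<close> runs \<open>U\<close> and applies the Cauchy name,
  which costs only a constant.\<close>

lemma computable_imp_locally_C_trivial:
  assumes U: "optimal_machine U" and x: "computable_point q x"
  shows "locally_C_trivial U q x"
proof -
  from x obtain \<alpha> where \<alpha>: "total_computable \<alpha>"
    "\<And>s t. s \<le> t \<Longrightarrow> dist (q (\<alpha> s)) (q (\<alpha> t)) \<le> 1 / 2 ^ s" "(\<lambda>s. q (\<alpha> s)) \<longlonglongrightarrow> x"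
    unfolding computable_point_def by blast
  \<comment> \<open>The index \<open>Suc n\<close> gives strictness, since passing to the limit
    preserves only the weak inequality.\<close>
  have dist: "dist x (q (\<alpha> (Suc n))) < 1 / 2 ^ n" for n
  proof -
    have "dist (q (\<alpha> (Suc n))) x \<le> 1 / 2 ^ Suc n"
      by (rule Lim_dist_ubound[OF trivial_limit_sequentially \<alpha>(3)])
        (rule eventually_sequentiallyI, rule \<alpha>(2))
    also have "\<dots> < 1 / 2 ^ n" by (simp add: field_simps)
    finally show ?thesis by (simp add: dist_commute)
  qed
  define V where "V = (\<lambda>\<sigma>. map_option (\<lambda>n. pr (\<alpha> (Suc n)) n) (U \<sigma>))"
  have "partial_computable V"
  proof -
    obtain f where f: "\<And>x y. eval f x y \<longleftrightarrow> U x = Some y"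
      using U unfolding optimal_machine_def partial_computable_def by blast
    have "total_computable (\<lambda>n. pr (\<alpha> (Suc n)) n)" by (intro comp_intros tc_comp[OF \<alpha>(1)])
    then obtain h where h: "\<And>n y. eval h n y \<longleftrightarrow> y = pr (\<alpha> (Suc n)) n"
      unfolding total_computable_iff by blast
    show ?thesis
      unfolding partial_computable_def V_def
      by (rule exI[of _ "Comp h f"]) (auto simp: eval_Comp_iff f h)
  qed
  then obtain b where b:
    "\<And>\<sigma> y. V \<sigma> = Some y \<Longrightarrow> \<exists>\<tau>. U \<tau> = Some y \<and> slen \<tau> \<le> slen \<sigma> + b"
    using U unfolding optimal_machine_def by blast
  have "KC U (pr (\<alpha> (Suc n)) n) \<le> KC U n + b" for n
  proof -
    obtain \<sigma> where \<sigma>: "U \<sigma> = Some n" "slen \<sigma> = KC U n" using KC_attained[OF U] by blast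
    then obtain \<tau> where "U \<tau> = Some (pr (\<alpha> (Suc n)) n)" "slen \<tau> \<le> slen \<sigma> + b"
      using b[of \<sigma>] by (auto simp: V_def)
    with \<sigma>(2) show ?thesis using KC_le by (metis le_trans)
  qed
  with dist show ?thesis unfolding locally_C_trivial_def by blast
qed

text \<open>At most \<open>2 B (k + 1)\<close> programs are shared out among \<open>k + 1\<close> values of \<open>n\<close>.\<close>

lemma few_programs:
  fixes U :: "nat \<Rightarrow> nat option"
  obtains n where "k < n" "n < 2 * k + 2"
    "card {\<sigma>. \<sigma> < B * (n + 1) \<and> (\<exists>p. U \<sigma> = Some (pr p n))} \<le> 2 * B"
proof (rule ccontr)
  define S where "S n = {\<sigma>. \<sigma> < B * (n + 1) \<and> (\<exists>p. U \<sigma> = Some (pr p n))}" for n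
  assume "\<not> thesis"
  then have ge: "n \<in> {k<..<2 * k + 2} \<Longrightarrow> 2 * B + 1 \<le> card (S n)" for n
    using that[of n] by (fastforce simp: S_def)
  have "(k + 1) * (2 * B + 1) = (\<Sum>n\<in>{k<..<2 * k + 2}. 2 * B + 1)" by simp
  also have "\<dots> \<le> (\<Sum>n\<in>{k<..<2 * k + 2}. card (S n))" by (rule sum_mono) (rule ge)
  \<comment> \<open>A program has at most one output, and that output determines \<open>n\<close>;
    hence the sets are disjoint.\<close>
  also have "\<dots> = card (\<Union>n\<in>{k<..<2 * k + 2}. S n)"
    by (rule card_UN_disjoint[symmetric]) (auto simp: S_def)
  also have "\<dots> \<le> card {..<B * (2 * k + 2)}"
  proof (rule card_mono)
    show "(\<Union>n\<in>{k<..<2 * k + 2}. S n) \<subseteq> {..<B * (2 * k + 2)}"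
    proof
      fix \<sigma>
      assume "\<sigma> \<in> (\<Union>n\<in>{k<..<2 * k + 2}. S n)"
      then obtain n where "n < 2 * k + 2" "\<sigma> < B * (n + 1)" unfolding S_def by auto
      moreover from this have "B * (n + 1) \<le> B * (2 * k + 2)" by (intro mult_left_mono) auto
      ultimately show "\<sigma> \<in> {..<B * (2 * k + 2)}" unfolding lessThan_iff by linarith
    qed
  qed simp
  finally show False by (simp add: algebra_simps)
qed

lemma locally_C_trivial_imp_computable:
  fixes q :: "nat \<Rightarrow> 'a::complete_space"
  assumes q: "computable_metric_space q" and U: "optimal_machine U"
    and x: "locally_C_trivial U q x"
  shows "computable_point q x"
proof -
  obtain b where b: "\<And>n. \<exists>p. dist x (q p) < 1 / 2 ^ n \<and> KC U (pr p n) \<le> KC U n + b"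
    using x unfolding locally_C_trivial_def by blast
  obtain c where c: "\<And>x. \<exists>\<tau>. U \<tau> = Some x \<and> slen \<tau> \<le> slen x + c"
    using optimal_machine_program_length[OF U] by blast
  \<comment> \<open>The program for the pair has length at most \<open>slen n + b + c\<close>. One
    more bit bounds its code, and \<open>2 ^ slen n\<close> is at most \<open>n + 1\<close>.\<close>
  define B :: nat where "B = 2 ^ (b + c + 1)"
  have short: "\<exists>p \<sigma>. dist x (q p) < 1 / 2 ^ n \<and> \<sigma> < B * (n + 1) \<and> U \<sigma> = Some (pr p n)" for n
  proof -
    obtain p where p: "dist x (q p) < 1 / 2 ^ n" "KC U (pr p n) \<le> KC U n + b" using b by blast
    obtain \<tau> where \<tau>: "U \<tau> = Some n" "slen \<tau> \<le> slen n + c" using c by blast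
    obtain \<sigma> where \<sigma>: "U \<sigma> = Some (pr p n)" "slen \<sigma> = KC U (pr p n)"
      using KC_attained[OF U] by blast
    have "slen \<sigma> + 1 \<le> (b + c + 1) + slen n" using KC_le[of U \<tau> n, OF \<tau>(1)] \<tau>(2) \<sigma>(2) p(2) by simp
    then have "(2::nat) ^ (slen \<sigma> + 1) \<le> B * 2 ^ slen n"
      unfolding B_def power_add[symmetric] by (rule power_increasing) simp
    also have "\<dots> \<le> B * (n + 1)" using slen_bounds(1) by (rule mult_left_mono) simp
    finally show ?thesis using slen_bounds(2)[of \<sigma>] \<sigma>(1) p(1) by (metis add_lessD1 less_le_trans)
  qed
  \<comment> \<open>Asking for all \<open>n < 2 * k + 2\<close> makes \<open>A\<close> decreasing
    and avoids having to find the \<open>n\<close> with few programs, of which only existence is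
    known. The tolerance is doubled because \<open>p\<close> and \<open>p'\<close> may each be
    almost \<open>1 / 2 ^ n\<close> away from \<open>x\<close>.\<close>
  define A where "A k = {p. \<forall>n<2 * k + 2. \<exists>\<sigma> p'. \<sigma> < B * (n + 1) \<and> U \<sigma> = Some (pr p' n) \<and>
    dist (q p) (q p') < real 2 / 2 ^ n}" for k
  obtain f where f: "\<And>x y. U x = Some y \<longleftrightarrow> eval f x y"
    using U unfolding optimal_machine_def partial_computable_def by metis
  show ?thesis
  proof (rule computable_point_of_semidec_sets[OF q])
    show "semidec (\<lambda>z. p1 z \<in> A (p2 z))"
      unfolding A_def mem_Collect_eq f
      by (intro semidec_all_less semidec_ex semidec_conj semidec_dist_less[OF q]
          semidec_comp2[OF semidec_eval] dec_imp_semidec comp_intros)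
    show "decseq A" by (rule decseq_SucI) (auto simp: A_def)
  next
    fix k p
    assume p: "dist x (q p) < 1 / 2 ^ (2 * k + 2)"
    show "p \<in> A k"
      unfolding A_def mem_Collect_eq
    proof (intro allI impI)
      fix n
      assume "n < 2 * k + 2"
      then have "(1::real) / 2 ^ (2 * k + 2) \<le> 1 / 2 ^ n"
        by (intro divide_left_mono power_increasing) auto
      moreover obtain p' \<sigma> where p': "dist x (q p') < 1 / 2 ^ n" "\<sigma> < B * (n + 1)"
        "U \<sigma> = Some (pr p' n)" using short by blast
      ultimately have "dist (q p) (q p') < 1 / 2 ^ n + 1 / 2 ^ n"
        using p dist_triangle3[of "q p" "q p'" x] by linarith
      then have "dist (q p) (q p') < real 2 / 2 ^ n" by simp
      with p'(2,3) show "\<exists>\<sigma> p'. \<sigma> < B * (n + 1) \<and> U \<sigma> = Some (pr p' n) \<and>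
          dist (q p) (q p') < real 2 / 2 ^ n" by blast
    qed
  next
    fix k g
    show "\<not> separated q (A k) (4 / 2 ^ k) (Suc (2 * B)) g"
    proof
      assume sep: "separated q (A k) (4 / 2 ^ k) (Suc (2 * B)) g"
      obtain n where n: "k < n" "n < 2 * k + 2"
        and few: "card {\<sigma>. \<sigma> < B * (n + 1) \<and> (\<exists>p. U \<sigma> = Some (pr p n))} \<le> 2 * B"
        using few_programs by blast
      have "\<forall>i<Suc (2 * B). \<exists>\<sigma> p'. \<sigma> < B * (n + 1) \<and> U \<sigma> = Some (pr p' n) \<and>
          dist (q (g i)) (q p') < real 2 / 2 ^ n"
        using sep n(2) by (auto simp: separated_def A_def)
      then obtain \<sigma> p' where \<sigma>: "\<And>i. i < Suc (2 * B) \<Longrightarrow> \<sigma> i < B * (n + 1)"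
        "\<And>i. i < Suc (2 * B) \<Longrightarrow> U (\<sigma> i) = Some (pr (p' i) n)"
        "\<And>i. i < Suc (2 * B) \<Longrightarrow> dist (q (g i)) (q (p' i)) < 2 / 2 ^ n"
        by (metis of_nat_numeral)
      \<comment> \<open>Points sharing a program share \<open>p'\<close>, so they are less than
        \<open>4 / 2 ^ n\<close> apart, too close because \<open>k < n\<close>. Thus
        \<open>2 * B + 1\<close> separated points would need as many programs.\<close>
      have neq: "\<sigma> i \<noteq> \<sigma> j" if "i < Suc (2 * B)" "j < i" for i j
      proof
        assume "\<sigma> i = \<sigma> j"
        with \<sigma>(2)[of i] \<sigma>(2)[of j] that have "p' i = p' j" by simp
        with \<sigma>(3)[of i] \<sigma>(3)[of j] that
        have "dist (q (g i)) (q (g j)) < 2 / 2 ^ n + 2 / 2 ^ n"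
          using dist_triangle2[of "q (g i)" "q (g j)" "q (p' i)"] by simp
        also have "\<dots> = 4 / 2 ^ n" by simp
        also have "\<dots> \<le> 4 / 2 ^ k" using n(1) by (intro divide_left_mono power_increasing) auto
        finally show False using sep that unfolding separated_def by (meson less_asym)
      qed
      have "inj_on \<sigma> {..<Suc (2 * B)}"
        by (rule linorder_inj_onI') (metis lessThan_iff neq)
      then have "Suc (2 * B) = card (\<sigma> ` {..<Suc (2 * B)})" by (simp add: card_image)
      also have "\<dots> \<le> card {\<sigma>. \<sigma> < B * (n + 1) \<and> (\<exists>p. U \<sigma> = Some (pr p n))}"
        using \<sigma>(1,2) by (intro card_mono) auto
      finally show False using few by simp
    qed
  qed
qed

theorem mainTheorem19:
  fixes q :: "nat \<Rightarrow> 'a::complete_space" and x :: 'a and U :: "nat \<Rightarrow> nat option"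
  assumes "computable_metric_space q"
    and "optimal_machine U"
  shows "computable_point q x \<longleftrightarrow> locally_C_trivial U q x"
  using assms computable_imp_locally_C_trivial locally_C_trivial_imp_computable by blast

end
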